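(* Let $W$ be a Coxeter group of rank at least $2$ (the rank being allowed to be infinite), with set of non-identity involutions $\mathcal{I}(W)$ and excess zero graph $\mathcal{E}_0(W)$. (i) If $W$ is finite with longest element $w_0$, then $\mathcal{E}_0(W)$ has exactly two connected components, with vertex sets $\mathcal{I}(W)\setminus\{w_0\}$ and $\{w_0\}$. If $W$ is infinite, then $\mathcal{E}_0(W)$ is connected. (ii) Let $\widehat{\mathcal{E}}_0(W)$ be the connected component of $\mathcal{E}_0(W)$ not containing $w_0$ (so $\widehat{\mathcal{E}}_0(W)=\mathcal{E}_0(W)$ when $W$ is infinite). Then the diameter of $\widehat{\mathcal{E}}_0(W)$ is at most $3$.
   Context: $W$ is a Coxeter group with set $R$ of fundamental (simple) reflections, rank $|R|$, and length function $\ell$ with respect to $R$. $\mathcal{I}(W)$ is the set of elements of $W$ of order exactly $2$. The excess zero graph $\mathcal{E}_0(W)$ is the undirected graph with vertex set $\mathcal{I}(W)$ in which $x,y$ are adjacent whenever $\ell(xy)=\ell(x)+\ell(y)$. The longest element $w_0$ exists only when $W$ is finite. *)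

theory Defs
  imports
    "HOL-Algebra.Multiplicative_Group"
    "HOL-Algebra.Generated_Groups"
    "HOL-Library.Extended_Nat"
    "Graph_Theory.Digraph_Component"
    "Graph_Theory.Shortest_Path"
begin

section \<open>Group presentations\<close>

text \<open>
  A word over \<open>S\<close> and its formal inverses is a list of signed letters; \<open>(s, True)\<close> stands for
  \<open>s\<close> and \<open>(s, False)\<close> for the formal inverse of \<open>s\<close>.
\<close>

type_synonym 'a signed_word = "('a \<times> bool) list"

definition letter_val :: "('a, 'b) monoid_scheme \<Rightarrow> 'a \<times> bool \<Rightarrow> 'a" where
  "letter_val G l = (if snd l then fst l else inv\<^bsub>G\<^esub> (fst l))"

definition word_val :: "('a, 'b) monoid_scheme \<Rightarrow> 'a signed_word \<Rightarrow> 'a" where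
  "word_val G w = foldr (\<lambda>l g. letter_val G l \<otimes>\<^bsub>G\<^esub> g) w \<one>\<^bsub>G\<^esub>"

text \<open>
  Equality of words in the abstract group \<open>\<langle>S | rels\<rangle>\<close>: the congruence generated by free
  cancellation and by the relators.
\<close>

inductive pres_eq :: "'a set \<Rightarrow> 'a signed_word set \<Rightarrow> 'a signed_word \<Rightarrow> 'a signed_word \<Rightarrow> bool"
  for S rels where
  refl: "pres_eq S rels u u"
| sym: "pres_eq S rels u v \<Longrightarrow> pres_eq S rels v u"
| trans: "pres_eq S rels u v \<Longrightarrow> pres_eq S rels v w \<Longrightarrow> pres_eq S rels u w"
| cong: "pres_eq S rels u v \<Longrightarrow> pres_eq S rels (p @ u @ q) (p @ v @ q)"
| cancel: "s \<in> S \<Longrightarrow> pres_eq S rels [(s, b), (s, \<not> b)] []"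
| relator: "r \<in> rels \<Longrightarrow> pres_eq S rels r []"

text \<open>
  \<open>G\<close> has the presentation \<open>\<langle>S | rels\<rangle>\<close>: the evaluation of words induces an isomorphism from
  the abstract group \<open>\<langle>S | rels\<rangle>\<close> onto \<open>G\<close>. The generation clause is surjectivity, and the two
  directions of the equivalence are injectivity and well-definedness.
\<close>

definition has_presentation :: "('a, 'b) monoid_scheme \<Rightarrow> 'a set \<Rightarrow> 'a signed_word set \<Rightarrow> bool" where
  "has_presentation G S rels \<longleftrightarrow>
     group G \<and> S \<subseteq> carrier G \<and> generate G S = carrier G \<and>
     (\<forall>w. set w \<subseteq> S \<times> UNIV \<longrightarrow> (word_val G w = \<one>\<^bsub>G\<^esub> \<longleftrightarrow> pres_eq S rels w []))"


section \<open>Coxeter groups\<close>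

definition coxeter_matrix :: "'a set \<Rightarrow> ('a \<Rightarrow> 'a \<Rightarrow> enat) \<Rightarrow> bool" where
  "coxeter_matrix R m \<longleftrightarrow>
     (\<forall>s\<in>R. \<forall>t\<in>R. m s t = m t s \<and> m s t \<noteq> 0 \<and> (m s t = 1 \<longleftrightarrow> s = t))"

definition coxeter_relators :: "'a set \<Rightarrow> ('a \<Rightarrow> 'a \<Rightarrow> enat) \<Rightarrow> 'a signed_word set" where
  "coxeter_relators R m =
     {concat (replicate k [(s, True), (t, True)]) | s t k. s \<in> R \<and> t \<in> R \<and> m s t = enat k}"

definition coxeter_group :: "('a, 'b) monoid_scheme \<Rightarrow> 'a set \<Rightarrow> bool" where
  "coxeter_group W R \<longleftrightarrow>
     (\<exists>m. coxeter_matrix R m \<and> has_presentation W R (coxeter_relators R m))"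

definition cox_length :: "('a, 'b) monoid_scheme \<Rightarrow> 'a set \<Rightarrow> 'a \<Rightarrow> nat" where
  "cox_length W R x =
     (LEAST n. \<exists>w. set w \<subseteq> R \<and> length w = n \<and> foldr (\<otimes>\<^bsub>W\<^esub>) w \<one>\<^bsub>W\<^esub> = x)"

definition longest_element :: "('a, 'b) monoid_scheme \<Rightarrow> 'a set \<Rightarrow> 'a \<Rightarrow> bool" where
  "longest_element W R w \<longleftrightarrow>
     w \<in> carrier W \<and> (\<forall>x\<in>carrier W. cox_length W R x \<le> cox_length W R w)"

definition involutions :: "('a, 'b) monoid_scheme \<Rightarrow> 'a set" where
  "involutions W = {x \<in> carrier W. group.ord W x = 2}"


section \<open>The excess zero graph\<close>

text \<open>
  An undirected graph is a symmetric digraph, as in \<open>Graph_Theory\<close>; symmetry of the excess zero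
  graph is proved below. For a symmetric digraph the strongly connected components \<open>sccs\<close> are the
  connected components.
\<close>

definition excess_zero_graph :: "('a, 'b) monoid_scheme \<Rightarrow> 'a set \<Rightarrow> 'a pair_pre_digraph" where
  "excess_zero_graph W R =
     \<lparr>pverts = involutions W,
      parcs = {(x, y). x \<in> involutions W \<and> y \<in> involutions W \<and>
                 cox_length W R (x \<otimes>\<^bsub>W\<^esub> y) = cox_length W R x + cox_length W R y}\<rparr>"

text \<open>
  The distance \<open>\<mu>\<close> with unit weights is the least number of arcs of a walk, and \<open>\<infinity>\<close> if there is
  none.
\<close>

definition diameter :: "('a, 'b) pre_digraph \<Rightarrow> ereal" where
  "diameter G = (SUP u\<in>verts G. SUP v\<in>verts G. wf_digraph.\<mu> G (\<lambda>_. 1) u v)"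

lemma coxeter_group_square:
  assumes "coxeter_group W R" and "r \<in> R"
  shows "r \<otimes>\<^bsub>W\<^esub> r = \<one>\<^bsub>W\<^esub>"
proof -
  from assms(1) obtain m where m: "coxeter_matrix R m"
    and p: "has_presentation W R (coxeter_relators R m)"
    unfolding coxeter_group_def by blast
  have "m r r = enat 1"
    using m assms(2) by (auto simp: coxeter_matrix_def one_enat_def)
  then have "concat (replicate 1 [(r, True), (r, True)]) \<in> coxeter_relators R m"
    unfolding coxeter_relators_def using assms(2) by blast
  then have "pres_eq R (coxeter_relators R m) [(r, True), (r, True)] []"
    by (simp add: pres_eq.relator)
  with p assms(2) have "word_val W [(r, True), (r, True)] = \<one>\<^bsub>W\<^esub>"
    unfolding has_presentation_def by force
  moreover have "group W" "r \<in> carrier W"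
    using p assms(2) by (auto simp: has_presentation_def)
  ultimately show ?thesis
    by (simp add: word_val_def letter_val_def group.is_monoid)
qed

lemma foldr_mult_rev:
  assumes "group W" "set w \<subseteq> carrier W" "\<And>r. r \<in> set w \<Longrightarrow> r \<otimes>\<^bsub>W\<^esub> r = \<one>\<^bsub>W\<^esub>"
  shows "foldr (\<otimes>\<^bsub>W\<^esub>) w \<one>\<^bsub>W\<^esub> \<in> carrier W \<and>
         foldr (\<otimes>\<^bsub>W\<^esub>) (rev w) \<one>\<^bsub>W\<^esub> = inv\<^bsub>W\<^esub> (foldr (\<otimes>\<^bsub>W\<^esub>) w \<one>\<^bsub>W\<^esub>)"
  using assms(2,3)
proof (induction w)
  case Nil
  interpret group W by fact
  show ?case by simp
next
  case (Cons r w)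
  interpret group W by fact
  have app: "foldr (\<otimes>\<^bsub>W\<^esub>) u g = foldr (\<otimes>\<^bsub>W\<^esub>) u \<one>\<^bsub>W\<^esub> \<otimes>\<^bsub>W\<^esub> g \<and>
             foldr (\<otimes>\<^bsub>W\<^esub>) u \<one>\<^bsub>W\<^esub> \<in> carrier W"
    if "set u \<subseteq> carrier W" "g \<in> carrier W" for u g
    using that by (induction u) (auto simp: m_assoc)
  have r: "r \<in> carrier W" "inv\<^bsub>W\<^esub> r = r"
    using Cons.prems by (auto intro: inv_equality)
  have w: "set (rev w) \<subseteq> carrier W" using Cons.prems by simp
  show ?case
    using Cons r app[OF w r(1)] by (simp add: inv_mult_group)
qed

lemma cox_length_inv:
  assumes "coxeter_group W R" and "x \<in> carrier W"
  shows "cox_length W R (inv\<^bsub>W\<^esub> x) = cox_length W R x"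
proof -
  have g: "group W" and R: "R \<subseteq> carrier W"
    using assms(1) by (auto simp: coxeter_group_def has_presentation_def)
  interpret group W by fact
  have rev: "foldr (\<otimes>\<^bsub>W\<^esub>) (rev w) \<one>\<^bsub>W\<^esub> = inv\<^bsub>W\<^esub> (foldr (\<otimes>\<^bsub>W\<^esub>) w \<one>\<^bsub>W\<^esub>)"
    if "set w \<subseteq> R" for w
    using foldr_mult_rev[OF g] that R coxeter_group_square[OF assms(1)] by (meson subset_iff)
  have imp: "\<exists>w. set w \<subseteq> R \<and> length w = n \<and> foldr (\<otimes>\<^bsub>W\<^esub>) w \<one>\<^bsub>W\<^esub> = inv\<^bsub>W\<^esub> y"
    if "\<exists>w. set w \<subseteq> R \<and> length w = n \<and> foldr (\<otimes>\<^bsub>W\<^esub>) w \<one>\<^bsub>W\<^esub> = y" for y n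
    using that rev by (metis length_rev set_rev)
  have "(\<exists>w. set w \<subseteq> R \<and> length w = n \<and> foldr (\<otimes>\<^bsub>W\<^esub>) w \<one>\<^bsub>W\<^esub> = inv\<^bsub>W\<^esub> x) \<longleftrightarrow>
        (\<exists>w. set w \<subseteq> R \<and> length w = n \<and> foldr (\<otimes>\<^bsub>W\<^esub>) w \<one>\<^bsub>W\<^esub> = x)" for n
    using imp[of n x] imp[of n "inv\<^bsub>W\<^esub> x"] assms(2) by auto
  then show ?thesis by (simp add: cox_length_def)
qed

lemma excess_zero_graph_symmetric:
  assumes "coxeter_group W R"
  shows "symmetric (excess_zero_graph W R)"
proof -
  interpret group W
    using assms by (auto simp: coxeter_group_def has_presentation_def)
  have inv: "x \<in> carrier W \<and> inv\<^bsub>W\<^esub> x = x" if "x \<in> involutions W" for x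
  proof -
    have x: "x \<in> carrier W" "ord x = 2" using that by (auto simp: involutions_def)
    then have "x [^]\<^bsub>W\<^esub> (2::nat) = \<one>\<^bsub>W\<^esub>" using pow_ord_eq_1[of x] by simp
    then show ?thesis using x by (auto simp: numeral_2_eq_2 intro: inv_equality)
  qed
  have "cox_length W R (y \<otimes>\<^bsub>W\<^esub> x) = cox_length W R (x \<otimes>\<^bsub>W\<^esub> y)"
    if "x \<in> involutions W" "y \<in> involutions W" for x y
    using cox_length_inv[OF assms, of "x \<otimes>\<^bsub>W\<^esub> y"] inv[OF that(1)] inv[OF that(2)]
    by (simp add: inv_mult_group)
  then show ?thesis
    by (auto simp: symmetric_def sym_def excess_zero_graph_def arcs_ends_def arc_to_ends_def
        with_proj_simps image_iff)
qed

end

theory Submission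
  imports Defs
begin

text \<open>
  If an involution \<open>x\<close> is not the longest element, some \<open>r \<in> R\<close> is not a descent of \<open>x\<close>, so \<open>x\<close> is
  adjacent to \<open>r\<close>. Distinct elements of \<open>R\<close> are adjacent, hence any two such involutions are joined
  by a walk \<open>x, r, s, y\<close> or \<open>x, r, y\<close>.

  That \<open>x\<close> is longest (and \<open>W\<close> finite) when every \<open>r \<in> R\<close> is a descent comes from the exchange
  condition: it shows that every \<open>y\<close> is then a prefix of \<open>x\<close>, that is,
  \<open>\<ell>(x) = \<ell>(y) + \<ell>(y\<inverse>x)\<close>. The exchange condition in turn holds because the parity with which a
  given reflection occurs among the reflections of a word is invariant under the Coxeter relations.
\<close>

lemma sum_lessThan_add:
  fixes f :: "nat \<Rightarrow> 'a :: comm_monoid_add"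
  shows "sum f {..<m + n} = sum f {..<m} + (\<Sum>i<n. f (m + i))"
  by (induction n) (auto simp: add.assoc)

section \<open>Words in the generators and their values\<close>

locale coxeter = group W for W :: "('a, 'b) monoid_scheme" (structure) and R :: "'a set" +
  assumes coxeter_group: "coxeter_group W R"
begin

abbreviation val :: "'a list \<Rightarrow> 'a" where
  "val w \<equiv> foldr (\<otimes>) w \<one>"

abbreviation len :: "'a \<Rightarrow> nat" where
  "len \<equiv> cox_length W R"

lemma R_closed: "R \<subseteq> carrier W"
  using coxeter_group by (auto simp: coxeter_group_def has_presentation_def)

lemma R_carrier [simp]: "r \<in> R \<Longrightarrow> r \<in> carrier W"
  using R_closed by blast

lemma R_square [simp]: "r \<in> R \<Longrightarrow> r \<otimes> r = \<one>"
  by (rule coxeter_group_square[OF coxeter_group])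

lemma R_inv [simp]: "r \<in> R \<Longrightarrow> inv r = r"
  by (rule inv_equality) auto

lemma R_cancel [simp]: "r \<in> R \<Longrightarrow> x \<in> carrier W \<Longrightarrow> r \<otimes> (r \<otimes> x) = x"
  using m_assoc[of r r x] by simp

lemma val_closed [simp]: "set w \<subseteq> R \<Longrightarrow> val w \<in> carrier W"
  by (induction w) auto

text \<open>As a simplification rule it would rewrite the value of a concatenation into a nested
  \<open>foldr\<close> before \<open>val_append\<close> could split it into a product.\<close>

declare foldr_append [simp del]

lemma val_append [simp]:
  "set u \<subseteq> R \<Longrightarrow> set v \<subseteq> R \<Longrightarrow> val (u @ v) = val u \<otimes> val v"
  by (induction u) (auto simp: m_assoc)

lemma val_rev [simp]: "set w \<subseteq> R \<Longrightarrow> val (rev w) = inv (val w)"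
  by (induction w) (auto simp: inv_mult_group)

section \<open>Reflections of a word counted modulo two\<close>

text \<open>
  \<open>inverts w t\<close> says that \<open>t\<close> occurs an odd number of times among the reflections
  \<open>s\<^sub>1 \<cdots> s\<^sub>i \<cdots> s\<^sub>1\<close> of the word \<open>w = s\<^sub>1 \<cdots> s\<^sub>k\<close>.
\<close>

primrec inverts :: "'a list \<Rightarrow> 'a \<Rightarrow> bool" where
  "inverts [] t \<longleftrightarrow> False"
| "inverts (s # w) t \<longleftrightarrow> ((s = t) \<noteq> inverts w (s \<otimes> t \<otimes> s))"

text \<open>The reflections of \<open>u @ v\<close> are those of \<open>u\<close> followed by those
  of \<open>v\<close> conjugated by \<open>val u\<close>, so the parities add.\<close>

lemma inverts_append:
  assumes "set u \<subseteq> R" "set v \<subseteq> R" "t \<in> carrier W"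
  shows "inverts (u @ v) t \<longleftrightarrow> (inverts u t \<noteq> inverts v (inv (val u) \<otimes> t \<otimes> val u))"
  using assms
proof (induction u arbitrary: t)
  case (Cons s u)
  have "inv (val (s # u)) \<otimes> t \<otimes> val (s # u) = inv (val u) \<otimes> (s \<otimes> t \<otimes> s) \<otimes> val u"
    using Cons.prems by (simp add: m_assoc inv_mult_group)
  with Cons show ?case by auto
qed simp

text \<open>The reflections of \<open>s t s t ...\<close> are the odd palindromes \<open>s\<close>,
  \<open>s t s\<close>, \<open>s t s t s\<close> and so on; the one at position \<open>i\<close>,
  counted from 0, is \<open>(s \<otimes> t) [^] i \<otimes> s\<close>.\<close>

lemma inverts_alternating:
  assumes "s \<in> R" "t \<in> R" "x \<in> carrier W"
  shows "inverts (concat (replicate k [s, t])) x \<longleftrightarrow>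
    odd (\<Sum>i<2 * k. of_bool (x = (s \<otimes> t) [^] i \<otimes> s) :: nat)"
  using assms(3)
proof (induction k arbitrary: x)
  case 0
  then show ?case by simp
next
  case (Suc k)
  let ?a = "s \<otimes> t"
  have cl: "?a [^] i \<in> carrier W" for i :: nat
    using assms by simp
  \<comment> \<open>Conjugation by the two leading letters lowers the exponent by two, so the
    remaining word supplies the indices from 2 on.\<close>
  have shift: "(t \<otimes> (s \<otimes> x \<otimes> s) \<otimes> t = ?a [^] i \<otimes> s) \<longleftrightarrow> (x = ?a [^] Suc (Suc i) \<otimes> s)" for i :: nat
  proof -
    have "x = ?a [^] Suc (Suc i) \<otimes> s \<longleftrightarrow> x = ?a \<otimes> (?a [^] i \<otimes> ?a) \<otimes> s"
      using assms cl nat_pow_Suc2[of ?a "Suc i"] by simp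
    also have "\<dots> \<longleftrightarrow> t \<otimes> (s \<otimes> x) = ?a [^] i \<otimes> ?a \<otimes> s"
    proof
      assume "x = ?a \<otimes> (?a [^] i \<otimes> ?a) \<otimes> s"
      then show "t \<otimes> (s \<otimes> x) = ?a [^] i \<otimes> ?a \<otimes> s"
        using assms cl by (simp add: m_assoc)
    next
      assume "t \<otimes> (s \<otimes> x) = ?a [^] i \<otimes> ?a \<otimes> s"
      then have "s \<otimes> (t \<otimes> (t \<otimes> (s \<otimes> x))) = s \<otimes> (t \<otimes> (?a [^] i \<otimes> ?a \<otimes> s))"
        by simp
      then show "x = ?a \<otimes> (?a [^] i \<otimes> ?a) \<otimes> s"
        using assms cl Suc.prems by (simp add: m_assoc)
    qed
    also have "\<dots> \<longleftrightarrow> t \<otimes> (s \<otimes> x \<otimes> s) \<otimes> t = ?a [^] i \<otimes> s"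
    proof
      assume "t \<otimes> (s \<otimes> x) = ?a [^] i \<otimes> ?a \<otimes> s"
      then have "t \<otimes> (s \<otimes> x) \<otimes> (s \<otimes> t) = ?a [^] i \<otimes> ?a \<otimes> s \<otimes> (s \<otimes> t)"
        by simp
      then show "t \<otimes> (s \<otimes> x \<otimes> s) \<otimes> t = ?a [^] i \<otimes> s"
        using assms cl Suc.prems by (simp add: m_assoc)
    next
      assume "t \<otimes> (s \<otimes> x \<otimes> s) \<otimes> t = ?a [^] i \<otimes> s"
      then have "t \<otimes> (s \<otimes> x \<otimes> s) \<otimes> t \<otimes> (t \<otimes> s) = ?a [^] i \<otimes> s \<otimes> (t \<otimes> s)"
        by simp
      then show "t \<otimes> (s \<otimes> x) = ?a [^] i \<otimes> ?a \<otimes> s"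
        using assms cl Suc.prems by (simp add: m_assoc)
    qed
    finally show ?thesis by simp
  qed
  have first: "(t = s \<otimes> x \<otimes> s) \<longleftrightarrow> (x = ?a \<otimes> s)"
  proof
    assume "t = s \<otimes> x \<otimes> s"
    then have "s \<otimes> t \<otimes> s = s \<otimes> (s \<otimes> x \<otimes> s) \<otimes> s" by simp
    then show "x = ?a \<otimes> s" using assms Suc.prems by (simp add: m_assoc)
  next
    assume "x = ?a \<otimes> s"
    then show "t = s \<otimes> x \<otimes> s" using assms by (simp add: m_assoc)
  qed
  have "inverts (concat (replicate (Suc k) [s, t])) x \<longleftrightarrow>
      ((s = x) \<noteq> ((t = s \<otimes> x \<otimes> s) \<noteq> inverts (concat (replicate k [s, t])) (t \<otimes> (s \<otimes> x \<otimes> s) \<otimes> t)))"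
    by simp
  also have "inverts (concat (replicate k [s, t])) (t \<otimes> (s \<otimes> x \<otimes> s) \<otimes> t) \<longleftrightarrow>
      odd (\<Sum>i<2 * k. of_bool (x = ?a [^] Suc (Suc i) \<otimes> s) :: nat)"
    unfolding shift[symmetric] using assms Suc.prems by (intro Suc.IH) simp
  finally have "inverts (concat (replicate (Suc k) [s, t])) x \<longleftrightarrow>
      odd (of_bool (x = s) + (of_bool (x = ?a \<otimes> s) +
        (\<Sum>i<2 * k. of_bool (x = ?a [^] Suc (Suc i) \<otimes> s) :: nat)))"
    unfolding first by (auto simp del: nat_pow_Suc)
  also have "of_bool (x = s) + (of_bool (x = ?a \<otimes> s) +
      (\<Sum>i<2 * k. of_bool (x = ?a [^] Suc (Suc i) \<otimes> s) :: nat)) =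
      (\<Sum>i<Suc (Suc (2 * k)). of_bool (x = ?a [^] i \<otimes> s))"
    unfolding sum.lessThan_Suc_shift using assms by (simp del: nat_pow_Suc add: nat_pow_Suc[of _ 0])
  finally show ?case by simp
qed

text \<open>The list of \<open>2 * k\<close> reflections runs twice through the same
  \<open>k\<close> entries, so every element occurs in it an even number of times.\<close>

lemma inverts_relator:
  assumes "s \<in> R" "t \<in> R" "x \<in> carrier W" "(s \<otimes> t) [^] k = \<one>"
  shows "\<not> inverts (concat (replicate k [s, t])) x"
proof -
  let ?f = "\<lambda>i. of_bool (x = (s \<otimes> t) [^] i \<otimes> s) :: nat"
  have period: "?f (k + i) = ?f i" for i
    using assms nat_pow_mult[of "s \<otimes> t" k i, symmetric] by simp
  have "(\<Sum>i<2 * k. ?f i) = (\<Sum>i<k. ?f i) + (\<Sum>i<k. ?f (k + i))"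
    unfolding mult_2 by (rule sum_lessThan_add)
  then show ?thesis
    using inverts_alternating[OF assms(1-3)] by (simp add: period)
qed

lemma val_alternating:
  assumes "s \<in> R" "t \<in> R"
  shows "val (concat (replicate k [s, t])) = (s \<otimes> t) [^] k"
proof (induction k)
  case (Suc k)
  have "(s \<otimes> t) [^] Suc k = (s \<otimes> t) \<otimes> (s \<otimes> t) [^] k"
    using assms nat_pow_Suc2 by simp
  with Suc show ?case using assms by (simp add: m_assoc del: nat_pow_Suc)
qed simp

text \<open>Generators are their own inverses, so the signed words of the presentation can be
  evaluated without their signs.\<close>

lemma word_val_eq_val:
  "set w \<subseteq> R \<times> UNIV \<Longrightarrow> word_val W w = val (map fst w)"
  by (induction w) (auto simp: word_val_def letter_val_def)

text \<open>
  The congruence rule allows arbitrary contexts, hence the first conjunct, which keeps track of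
  the words over \<open>R\<close>.
\<close>

lemma pres_eq_invariant:
  assumes rel: "\<And>r. r \<in> rels \<Longrightarrow> set r \<subseteq> R \<times> UNIV \<and> val (map fst r) = \<one> \<and> even (length r) \<and>
      (\<forall>x\<in>carrier W. \<not> inverts (map fst r) x)"
    and "pres_eq R rels u v"
  shows "(set u \<subseteq> R \<times> UNIV \<longleftrightarrow> set v \<subseteq> R \<times> UNIV) \<and>
    (set u \<subseteq> R \<times> UNIV \<longrightarrow> val (map fst u) = val (map fst v) \<and>
      (even (length u) \<longleftrightarrow> even (length v)) \<and>
      (\<forall>x\<in>carrier W. inverts (map fst u) x \<longleftrightarrow> inverts (map fst v) x))"
  using assms(2)
proof (induction rule: pres_eq.induct)
  case (cong u v p q)
  have R: "set (map fst w) \<subseteq> R" if "set w \<subseteq> R \<times> (UNIV :: bool set)" for w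
    using that by force
  show ?case
  proof (cases "set p \<subseteq> R \<times> UNIV \<and> set q \<subseteq> R \<times> UNIV \<and> set u \<subseteq> R \<times> UNIV")
    case True
    with cong.IH have uv: "set v \<subseteq> R \<times> UNIV" "val (map fst u) = val (map fst v)"
      "even (length u) \<longleftrightarrow> even (length v)"
      "\<And>x. x \<in> carrier W \<Longrightarrow> inverts (map fst u) x \<longleftrightarrow> inverts (map fst v) x"
      by blast+
    have sets: "set (map fst p) \<subseteq> R" "set (map fst q) \<subseteq> R" "set (map fst u) \<subseteq> R" "set (map fst v) \<subseteq> R"
      using R True uv(1) by blast+
    have "inverts (map fst (p @ u @ q)) x \<longleftrightarrow> inverts (map fst (p @ v @ q)) x" if "x \<in> carrier W" for x
      using that sets uv(2,4) by (simp add: inverts_append del: set_map)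
    moreover have "val (map fst (p @ u @ q)) = val (map fst (p @ v @ q))"
      using sets uv(2) by (simp del: set_map)
    ultimately show ?thesis using True uv(1,3) by simp
  next
    case False
    with cong show ?thesis by auto
  qed
next
  case (cancel s b)
  \<comment> \<open>Both letters of \<open>s s\<close> give the reflection \<open>s\<close>: the
    condition \<open>s = s \<otimes> x \<otimes> s\<close> from the second letter amounts to
    \<open>x \<otimes> s = \<one>\<close>, hence to \<open>s = x\<close>.\<close>
  have "s = x" if "x \<in> carrier W" "x \<otimes> s = \<one>" for x
    using inv_equality[of x s] that cancel by simp
  then show ?case using cancel by (auto simp: m_assoc)
next
  case (relator r)
  then show ?case using rel[of r] by auto
qed auto

text \<open>By the presentation, a word with value \<open>\<one>\<close> is derivable from the
  relators. Each relator has even length and inverts nothing, and the derivation preserves both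
  parities.\<close>

lemma pres_eq_Nil_invariant:
  assumes "set w \<subseteq> R" "val w = \<one>"
  shows "even (length w) \<and> (\<forall>x\<in>carrier W. \<not> inverts w x)"
proof -
  obtain m where p: "has_presentation W R (coxeter_relators R m)"
    using coxeter_group by (auto simp: coxeter_group_def)
  define S where "S = map (\<lambda>s. (s, True)) w"
  have S: "set S \<subseteq> R \<times> UNIV" "map fst S = w" "length S = length w"
    using assms(1) by (auto simp: S_def comp_def)
  have word: "word_val W u = \<one> \<longleftrightarrow> pres_eq R (coxeter_relators R m) u []" if "set u \<subseteq> R \<times> UNIV" for u
    using p that by (auto simp: has_presentation_def)
  have rel: "set r \<subseteq> R \<times> UNIV \<and> val (map fst r) = \<one> \<and> even (length r) \<and>
      (\<forall>x\<in>carrier W. \<not> inverts (map fst r) x)" if r: "r \<in> coxeter_relators R m" for r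
  proof -
    obtain s t k where st: "s \<in> R" "t \<in> R" and k: "r = concat (replicate k [(s, True), (t, True)])"
      using r by (auto simp: coxeter_relators_def)
    have rR: "set r \<subseteq> R \<times> UNIV" using st by (auto simp: k)
    have mr: "map fst r = concat (replicate k [s, t])"
      by (simp add: k map_concat)
    have "val (map fst r) = \<one>"
      using word[OF rR] word_val_eq_val[OF rR] pres_eq.relator[OF r] by simp
    moreover from this have "(s \<otimes> t) [^] k = \<one>"
      using val_alternating[OF st] mr by simp
    moreover have "even (length r)"
      by (simp add: k length_concat sum_list_replicate)
    ultimately show ?thesis
      using rR inverts_relator[OF st] mr by simp
  qed
  have "pres_eq R (coxeter_relators R m) S []"
    using word[OF S(1)] word_val_eq_val[OF S(1)] S(2) assms(2) by simp
  from pres_eq_invariant[OF rel this] S show ?thesis by simp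
qed

lemma same_val_invariant:
  assumes "set u \<subseteq> R" "set v \<subseteq> R" "val u = val v"
  shows even_length_eq: "even (length u) \<longleftrightarrow> even (length v)"
    and inverts_eq: "x \<in> carrier W \<Longrightarrow> inverts u x \<longleftrightarrow> inverts v x"
proof -
  \<comment> \<open>Taking \<open>w\<close> to be \<open>u\<close> and then \<open>v\<close>
    compares both with the same \<open>rev v\<close>, so the inversions of a reversed word need not
    be computed.\<close>
  have "even (length (w @ rev v)) \<and> (\<forall>x\<in>carrier W. \<not> inverts (w @ rev v) x)"
    if "set w \<subseteq> R" "val w = val v" for w
    using that assms by (intro pres_eq_Nil_invariant) auto
  from this[of u] this[of v] assms
  show "even (length u) \<longleftrightarrow> even (length v)"
    and "x \<in> carrier W \<Longrightarrow> inverts u x \<longleftrightarrow> inverts v x"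
    by (auto simp: inverts_append)
qed

text \<open>What occurs an odd number of times occurs at least once, so \<open>t\<close> is the
  reflection belonging to some letter \<open>s\<close>, and multiplying by it cancels exactly that
  letter.\<close>

lemma inverts_delete:
  assumes "inverts w t" "set w \<subseteq> R" "t \<in> carrier W"
  obtains u s v where "w = u @ s # v" "t = val u \<otimes> s \<otimes> inv (val u)" "t \<otimes> val w = val (u @ v)"
proof -
  have "\<exists>u s v. w = u @ s # v \<and> t = val u \<otimes> s \<otimes> inv (val u) \<and> t \<otimes> val w = val (u @ v)"
    using assms
  proof (induction w arbitrary: t)
    case Nil
    then show ?case by simp
  next
    case (Cons r w)
    then have r: "r \<in> R" and w: "set w \<subseteq> R" by auto
    show ?case
    proof (cases "r = t")
      case True
      then show ?thesis using r w by (intro exI[of _ "[]"] exI[of _ r] exI[of _ w]) simp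
    next
      case False
      let ?t = "r \<otimes> t \<otimes> r"
      have "inverts w ?t" "?t \<in> carrier W" using Cons.prems False by auto
      from Cons.IH[OF this(1) w this(2)] obtain u s v where
        uv: "w = u @ s # v" "?t = val u \<otimes> s \<otimes> inv (val u)" "?t \<otimes> val w = val (u @ v)"
        by blast
      have sets: "set u \<subseteq> R" "s \<in> R" "set v \<subseteq> R" using uv(1) w by auto
      have "t = r \<otimes> ?t \<otimes> r" using r Cons.prems(3) by (simp add: m_assoc)
      also have "\<dots> = val (r # u) \<otimes> s \<otimes> inv (val (r # u))"
        unfolding uv(2) using r sets by (simp add: m_assoc inv_mult_group)
      finally have 1: "t = val (r # u) \<otimes> s \<otimes> inv (val (r # u))" .
      have "t \<otimes> val (r # w) = r \<otimes> (?t \<otimes> val w)"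
        using r w Cons.prems(3) by (simp add: m_assoc)
      also have "\<dots> = val ((r # u) @ v)" unfolding uv(3) by simp
      finally have "t \<otimes> val (r # w) = val ((r # u) @ v)" .
      with 1 uv(1) show ?thesis
        by (intro exI[of _ "r # u"] exI[of _ s] exI[of _ v]) simp
    qed
  qed
  then show ?thesis using that by blast
qed

section \<open>The length function and the exchange condition\<close>

lemma ex_word:
  assumes "x \<in> carrier W"
  shows "\<exists>w. set w \<subseteq> R \<and> val w = x"
proof -
  have "x \<in> generate W R"
    using assms coxeter_group by (auto simp: coxeter_group_def has_presentation_def)
  then show ?thesis
  proof (induction rule: generate.induct)
    case one
    show ?case by (intro exI[of _ "[]"]) simp
  next
    case (incl h)
    then show ?case by (intro exI[of _ "[h]"]) simp
  next
    case (inv h)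
    then show ?case by (intro exI[of _ "[h]"]) simp
  next
    case (eng h1 h2)
    then obtain u v where "set u \<subseteq> R" "val u = h1" "set v \<subseteq> R" "val v = h2" by blast
    then show ?case by (intro exI[of _ "u @ v"]) auto
  qed
qed

lemma reduced_word:
  assumes "x \<in> carrier W"
  obtains w where "set w \<subseteq> R" "length w = len x" "val w = x"
  using LeastI_ex[of "\<lambda>n. \<exists>w. set w \<subseteq> R \<and> length w = n \<and> val w = x"] ex_word[OF assms]
  by (auto simp: cox_length_def)

lemma len_le: "set w \<subseteq> R \<Longrightarrow> len (val w) \<le> length w"
  unfolding cox_length_def by (rule Least_le) auto

lemma len_one [simp]: "len \<one> = 0"
  using len_le[of "[]"] by simp

lemma len_eq_0_iff: "x \<in> carrier W \<Longrightarrow> len x = 0 \<longleftrightarrow> x = \<one>"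
  by (metis foldr.simps(1) id_apply len_one length_0_conv reduced_word)

lemma len_mult_le:
  assumes "x \<in> carrier W" "y \<in> carrier W"
  shows "len (x \<otimes> y) \<le> len x + len y"
proof -
  obtain u v where "set u \<subseteq> R" "length u = len x" "val u = x" "set v \<subseteq> R" "length v = len y" "val v = y"
    using assms reduced_word by metis
  then show ?thesis using len_le[of "u @ v"] by simp
qed

text \<open>All words for one element have lengths of the same parity, a reduced word
  included.\<close>

lemma even_len: "set w \<subseteq> R \<Longrightarrow> even (len (val w)) \<longleftrightarrow> even (length w)"
  by (metis even_length_eq reduced_word val_closed)

lemma len_R [simp]: "r \<in> R \<Longrightarrow> len r = 1"
  using even_len[of "[r]"] len_le[of "[r]"] by (cases "len r") auto

text \<open>Parity rules out equal lengths, and the triangle inequality applies in both directions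
  because \<open>r\<close> is its own inverse.\<close>

lemma len_mult_R:
  assumes "r \<in> R" "x \<in> carrier W"
  shows "len (r \<otimes> x) = len x + 1 \<or> len x = len (r \<otimes> x) + 1"
proof -
  obtain w where w: "set w \<subseteq> R" "length w = len x" "val w = x"
    using assms(2) reduced_word by metis
  have "even (len (r \<otimes> x)) \<longleftrightarrow> odd (len x)"
    using even_len[of "r # w"] w assms by simp
  then have "len (r \<otimes> x) \<noteq> len x" by auto
  moreover have "len (r \<otimes> x) \<le> len x + 1"
    using len_mult_le[of r x] assms by simp
  moreover have "len x \<le> len (r \<otimes> x) + 1"
    using len_mult_le[of r "r \<otimes> x"] assms by simp
  ultimately show ?thesis by linarith
qed

text \<open>This makes distinct generators adjacent in the excess zero graph. Multiplying by a
  generator changes the length 1 to 0 or 2, and 0 would force \<open>r = s\<close>.\<close>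

lemma len_mult_distinct:
  assumes "r \<in> R" "s \<in> R" "r \<noteq> s"
  shows "len (r \<otimes> s) = 2"
proof -
  have "r \<otimes> s \<noteq> \<one>" using assms by (metis R_carrier R_inv inv_equality)
  then show ?thesis
    using len_mult_R[of r s] assms len_eq_0_iff[of "r \<otimes> s"] by auto
qed

text \<open>A reduced word \<open>w'\<close> of \<open>s \<otimes> val w\<close> cannot invert
  \<open>s\<close>, since deleting a letter would give too short a word for \<open>val w\<close>.
  Hence \<open>s # w'\<close> inverts \<open>s\<close>, and so does \<open>w\<close>, which has the
  same value; \<open>inverts_delete\<close> then yields the letter. Only \<open>w'\<close> is
  reduced; \<open>w\<close> is any word.\<close>

lemma exchange:
  assumes w: "set w \<subseteq> R" and s: "s \<in> R" and lt: "len (s \<otimes> val w) < len (val w)"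
  obtains u r v where "w = u @ r # v" "s = val u \<otimes> r \<otimes> inv (val u)" "s \<otimes> val w = val (u @ v)"
proof -
  obtain w' where w': "set w' \<subseteq> R" "length w' = len (s \<otimes> val w)" "val w' = s \<otimes> val w"
    using reduced_word[of "s \<otimes> val w"] w s by auto
  have "\<not> inverts w' s"
  proof
    assume "inverts w' s"
    then obtain u r v where uv: "w' = u @ r # v" "s \<otimes> val w' = val (u @ v)"
      using inverts_delete[OF _ w'(1) R_carrier[OF s]] by blast
    have "val w = val (u @ v)" using uv(2) w'(3) w s by simp
    moreover have "set (u @ v) \<subseteq> R" using uv(1) w'(1) by auto
    ultimately have "len (val w) \<le> length (u @ v)" using len_le by metis
    then show False using lt uv(1) w'(2) by simp
  qed
  then have "inverts (s # w') s" using s by (simp add: m_assoc)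
  then have "inverts w s"
    using inverts_eq[of "s # w'" w s] w w' s by simp
  from inverts_delete[OF this w] s that show ?thesis by auto
qed

section \<open>Elements having every generator as a left descent\<close>

context
  fixes x
  assumes x: "x \<in> carrier W" and descents: "\<And>s. s \<in> R \<Longrightarrow> len (s \<otimes> x) < len x"
begin

text \<open>Let \<open>y\<close> be \<open>s\<close> times the value of \<open>z\<close>. If
  \<open>s\<close> lengthens \<open>val z\<close>, write \<open>x\<close> as a reduced word
  \<open>p\<close> of \<open>val z\<close> followed by a reduced word \<open>q\<close> of the rest,
  and exchange the descent \<open>s\<close>. The deleted letter cannot lie in \<open>p\<close>, so
  it lies in \<open>q\<close>, and the prefix \<open>val z\<close> extends to
  \<open>s \<otimes> val z\<close>.\<close>

lemma prefix_of_longest: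
  assumes "y \<in> carrier W"
  shows "len x = len y + len (inv y \<otimes> x)"
proof -
  have "len x = len (val w) + len (inv (val w) \<otimes> x)" if "set w \<subseteq> R" for w
    using that
  proof (induction w rule: length_induct)
    case (1 w)
    show ?case
    proof (cases w)
      case Nil
      then show ?thesis using x by simp
    next
      case (Cons s z)
      then have s: "s \<in> R" and z: "set z \<subseteq> R" using 1 by auto
      have IH: "len x = len (val z) + len (inv (val z) \<otimes> x)"
        using 1 Cons by simp
      show ?thesis
      proof (cases "len (val w) < len (val z)")
        case True
        \<comment> \<open>Here \<open>w\<close> is not reduced. A reduced replacement is shorter but
          need not be a suffix of \<open>w\<close>, which is why the induction is on length.\<close>
        obtain w' where w': "set w' \<subseteq> R" "length w' = len (val w)" "val w' = val w"
          using reduced_word[of "val w"] 1 by auto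
        have "length w' < length w"
          using w'(2) True len_le[OF z] Cons by simp
        then show ?thesis using 1 w' by metis
      next
        case False
        then have lw: "len (val w) = len (val z) + 1"
          using len_mult_R[OF s, of "val z"] z Cons by auto
        obtain p where p: "set p \<subseteq> R" "length p = len (val z)" "val p = val z"
          using reduced_word[of "val z"] z by auto
        obtain q where q: "set q \<subseteq> R" "length q = len (inv (val z) \<otimes> x)" "val q = inv (val z) \<otimes> x"
          using reduced_word[of "inv (val z) \<otimes> x"] z x by auto
        have pq: "val (p @ q) = x" "set (p @ q) \<subseteq> R"
          using p q z x m_assoc[of "val z" "inv (val z)" x] by simp_all
        obtain u r v where uv: "p @ q = u @ r # v" "s \<otimes> val (p @ q) = val (u @ v)"
          using exchange[OF pq(2) s] descents[OF s] pq(1) by metis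
        show ?thesis
        proof (cases "length u < length p")
          case True
          text \<open>The deleted letter lies in \<open>p\<close>, so \<open>s \<otimes> val p\<close> is too short.\<close>
          obtain p' where p': "p = u @ r # p'" "v = p' @ q"
            using uv(1) True by (auto simp: append_eq_append_conv2 append_eq_Cons_conv)
          have sets: "set u \<subseteq> R" "r \<in> R" "set p' \<subseteq> R" using p' p by auto
          have "s \<otimes> val p \<otimes> val q = s \<otimes> val (p @ q)"
            using p(1) q(1) s by (simp add: m_assoc)
          also have "\<dots> = val (u @ p') \<otimes> val q"
            unfolding uv(2) p'(2) using q(1) sets by (simp add: m_assoc)
          finally have "s \<otimes> val p \<otimes> val q = val (u @ p') \<otimes> val q" .
          moreover have "s \<otimes> val p \<in> carrier W" "val (u @ p') \<in> carrier W" "val q \<in> carrier W"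
            using p(1) q(1) s sets by simp_all
          ultimately have "s \<otimes> val p = val (u @ p')"
            using right_cancel by blast
          then have "len (val w) \<le> length (u @ p')"
            using len_le[of "u @ p'"] sets Cons p(3) by simp
          then show ?thesis using lw p p' by simp
        next
          case False
          \<comment> \<open>The deleted letter lies in \<open>q\<close>, which leaves a word for
            \<open>inv (val w) \<otimes> x\<close> one letter shorter than \<open>q\<close>.\<close>
          then obtain u' where u': "u = p @ u'" "q = u' @ r # v"
            using uv(1) by (auto simp: append_eq_append_conv2 append_eq_Cons_conv)
          have sets: "set u' \<subseteq> R" "r \<in> R" "set v \<subseteq> R" using u' q by auto
          have "s \<otimes> x = val p \<otimes> val (u' @ v)"
            using uv(2) pq u' p sets by (simp add: m_assoc)
          then have "s \<otimes> (s \<otimes> x) = s \<otimes> (val p \<otimes> val (u' @ v))" by simp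
          then have "x = val w \<otimes> val (u' @ v)"
            using p s sets x Cons z by (simp add: m_assoc)
          then have eq: "inv (val w) \<otimes> x = val (u' @ v)"
            using 1 sets by (simp flip: m_assoc)
          have "len (inv (val w) \<otimes> x) \<le> length (u' @ v)"
            unfolding eq using sets by (intro len_le) auto
          then have "len (val w) + len (inv (val w) \<otimes> x) \<le> len x"
            using lw IH q(2) u'(2) by simp
          moreover have "len x \<le> len (val w) + len (inv (val w) \<otimes> x)"
            using len_mult_le[of "val w" "inv (val w) \<otimes> x"] 1 x by (simp flip: m_assoc)
          ultimately show ?thesis by simp
        qed
      qed
    qed
  qed
  then show ?thesis using ex_word[OF assms] by blast
qed

lemma longest_if_descents: "longest_element W R x"
  using prefix_of_longest x by (simp add: longest_element_def)

text \<open>Maximality of \<open>y\<close> forces the second summand in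
  \<open>prefix_of_longest\<close> to vanish.\<close>

lemma longest_eq: "longest_element W R y \<Longrightarrow> y = x"
proof -
  assume y: "longest_element W R y"
  then have "y \<in> carrier W" "len x \<le> len y" using x by (auto simp: longest_element_def)
  then have "inv y \<otimes> x = \<one>"
    using prefix_of_longest[of y] len_eq_0_iff[of "inv y \<otimes> x"] x by simp
  then show "y = x"
    using \<open>y \<in> carrier W\<close> x inv_solve_left' by fastforce
qed

text \<open>Exchange on one fixed word of \<open>x\<close> exhibits every generator among the
  finitely many reflections of that word, so \<open>R\<close> is finite. As lengths are bounded by
  \<open>len x\<close>, finitely many words reach all of \<open>W\<close>.\<close>

lemma finite_if_descents: "finite (carrier W)"
proof -
  obtain w where w: "set w \<subseteq> R" "val w = x"
    using ex_word[OF x] by blast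
  have "R \<subseteq> (\<lambda>i. val (take i w) \<otimes> w ! i \<otimes> inv (val (take i w))) ` {..<length w}"
  proof
    fix s assume "s \<in> R"
    from exchange[OF w(1) this] descents[OF this] w(2) obtain u r v where
      "w = u @ r # v" "s = val u \<otimes> r \<otimes> inv (val u)" by metis
    then show "s \<in> (\<lambda>i. val (take i w) \<otimes> w ! i \<otimes> inv (val (take i w))) ` {..<length w}"
      by (intro image_eqI[of _ _ "length u"]) auto
  qed
  then have "finite R" by (rule finite_subset) simp
  then have "finite (val ` {w. set w \<subseteq> R \<and> length w \<le> len x})"
    by (simp add: finite_lists_length_le)
  moreover have "carrier W \<subseteq> val ` {w. set w \<subseteq> R \<and> length w \<le> len x}"
  proof
    fix y assume y: "y \<in> carrier W"
    then obtain w where "set w \<subseteq> R" "length w = len y" "val w = y"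
      using reduced_word by blast
    then show "y \<in> val ` {w. set w \<subseteq> R \<and> length w \<le> len x}"
      using prefix_of_longest[OF y] by (intro image_eqI[of _ _ w]) auto
  qed
  ultimately show ?thesis by (rule rev_finite_subset)
qed

end

lemma descents_longest:
  assumes "longest_element W R x" "s \<in> R"
  shows "len (s \<otimes> x) < len x"
proof -
  have "x \<in> carrier W" "len (s \<otimes> x) \<le> len x"
    using assms by (auto simp: longest_element_def)
  then show ?thesis using len_mult_R[OF assms(2), of x] by linarith
qed

lemma longest_unique:
  assumes "longest_element W R x" "longest_element W R y"
  shows "x = y"
  using longest_eq[of y x] descents_longest assms by (auto simp: longest_element_def)

text \<open>Contrapositive of the two preceding consequences: if every generator were a descent,
  \<open>x\<close> would be longest and \<open>W\<close> finite.\<close>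

lemma ex_ascent:
  assumes "x \<in> carrier W" "\<not> (finite (carrier W) \<and> longest_element W R x)"
  obtains r where "r \<in> R" "len (r \<otimes> x) = 1 + len x"
proof -
  obtain r where "r \<in> R" "\<not> len (r \<otimes> x) < len x"
    using assms longest_if_descents finite_if_descents by blast
  then show ?thesis using that[of r] len_mult_R[of r x] assms(1) by auto
qed

section \<open>Involutions and the excess zero graph\<close>

lemma involutions_iff: "x \<in> involutions W \<longleftrightarrow> x \<in> carrier W \<and> x \<noteq> \<one> \<and> x \<otimes> x = \<one>"
proof -
  have "ord x = 2 \<longleftrightarrow> x \<noteq> \<one> \<and> x \<otimes> x = \<one>" if x: "x \<in> carrier W"
  proof
    assume o: "ord x = 2"
    then have "x [^] (2 :: nat) = \<one>" using pow_ord_eq_1[OF x] by simp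
    then show "x \<noteq> \<one> \<and> x \<otimes> x = \<one>"
      using o ord_eq_1[OF x] x by (simp add: numeral_2_eq_2)
  next
    assume *: "x \<noteq> \<one> \<and> x \<otimes> x = \<one>"
    then have "ord x dvd 2"
      using x by (simp add: numeral_2_eq_2 flip: pow_eq_id)
    moreover have "ord x \<noteq> 1" using * x ord_eq_1 by blast
    ultimately show "ord x = 2"
      using dvd_imp_le[of "ord x" 2] by (cases "ord x = 0") auto
  qed
  then show ?thesis by (auto simp: involutions_def)
qed

lemma R_involutions: "R \<subseteq> involutions W"
  using len_one len_R by (fastforce simp: involutions_iff)

text \<open>Inversion preserves length, so uniqueness makes the longest element self-inverse. It is
  not \<open>\<one>\<close>, because a generator shortens it.\<close>

lemma longest_involution:
  assumes "longest_element W R x" "R \<noteq> {}"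
  shows "x \<in> involutions W"
proof -
  have x: "x \<in> carrier W" using assms by (simp add: longest_element_def)
  have "longest_element W R (inv x)"
    using assms x by (simp add: longest_element_def cox_length_inv[OF coxeter_group])
  then have "inv x = x" using longest_unique assms by blast
  then have "x \<otimes> x = \<one>" using x r_inv by metis
  moreover have "x \<noteq> \<one>" using descents_longest[OF assms(1)] assms(2) by force
  ultimately show ?thesis using x by (simp add: involutions_iff)
qed

text \<open>Components and diameter are defined for general digraphs; \<open>with_proj\<close> turns
  the pair digraph into one with the projections as \<open>tail\<close> and
  \<open>head\<close>.\<close>

abbreviation graph where "graph \<equiv> with_proj (excess_zero_graph W R)"

lemma graph_simps:
  "pverts (excess_zero_graph W R) = involutions W"
  "(x, y) \<in> parcs (excess_zero_graph W R) \<longleftrightarrow>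
    x \<in> involutions W \<and> y \<in> involutions W \<and> len (x \<otimes> y) = len x + len y"
  by (auto simp: excess_zero_graph_def)

lemma wf_graph: "wf_digraph graph"
  by unfold_locales (auto simp: excess_zero_graph_def)

lemma symmetric_graph: "(x, y) \<in> arcs graph \<Longrightarrow> (y, x) \<in> arcs graph"
  using excess_zero_graph_symmetric[OF coxeter_group] by (auto simp: symmetric_def dest: symD)

text \<open>A neighbour has positive length, so its product with \<open>w\<close> would be longer
  than \<open>w\<close>.\<close>

lemma longest_isolated:
  assumes "longest_element W R w"
  shows "(w, y) \<notin> arcs graph"
proof
  assume "(w, y) \<in> arcs graph"
  then have y: "y \<in> carrier W" "y \<noteq> \<one>" and "len (w \<otimes> y) = len w + len y"
    by (auto simp: graph_simps involutions_iff)
  moreover have "len (w \<otimes> y) \<le> len w"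
    using assms y by (simp add: longest_element_def)
  ultimately show False using len_eq_0_iff[OF y(1)] by simp
qed

lemma ex_arc_R:
  assumes "x \<in> involutions W" "\<not> (finite (carrier W) \<and> longest_element W R x)"
  obtains r where "r \<in> R" "(x, r) \<in> arcs graph" "(r, x) \<in> arcs graph"
proof -
  have "x \<in> carrier W" using assms(1) by (simp add: involutions_iff)
  then obtain r where r: "r \<in> R" "len (r \<otimes> x) = 1 + len x"
    using ex_ascent assms(2) by blast
  then have "(r, x) \<in> arcs graph"
    using assms(1) R_involutions by (auto simp: graph_simps)
  then show ?thesis using that r(1) symmetric_graph by blast
qed

text \<open>Stated for a subgraph \<open>H\<close> to serve both the whole graph of an infinite
  group and, in the finite case, the graph without the longest element. The inner vertices of the
  walk lie in \<open>R\<close>, hence in \<open>H\<close>.\<close>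

lemma short_awalk:
  assumes H: "wf_digraph H" "tail H = fst" "head H = snd"
    and arcs: "arcs H = {e \<in> arcs graph. fst e \<in> verts H \<and> snd e \<in> verts H}"
    and R: "R \<subseteq> verts H"
    and V: "verts H \<subseteq> {x \<in> involutions W. \<not> (finite (carrier W) \<and> longest_element W R x)}"
    and u: "u \<in> verts H" and v: "v \<in> verts H"
  shows "\<exists>p. pre_digraph.awalk H u p v \<and> length p \<le> 3"
proof -
  interpret H: wf_digraph H by fact
  obtain r where r: "r \<in> R" "(u, r) \<in> arcs graph"
    using ex_arc_R[of u] u V by blast
  obtain s where s: "s \<in> R" "(s, v) \<in> arcs graph"
    using ex_arc_R[of v] v V by blast
  show ?thesis
  proof (cases "r = s")
    case True
    have "H.awalk u [(u, r), (s, v)] v"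
      using True r s u v R by (auto simp: H.awalk_simps H(2,3) arcs)
    then show ?thesis by force
  next
    case False
    have "(r, s) \<in> arcs graph"
      using r s False R_involutions len_mult_distinct by (auto simp: graph_simps)
    then have "H.awalk u [(u, r), (r, s), (s, v)] v"
      using r s u v R by (auto simp: H.awalk_simps H(2,3) arcs)
    then show ?thesis by force
  qed
qed

end

section \<open>Components and diameter\<close>

lemma diameter_le:
  assumes "wf_digraph H"
    and "\<And>u v. u \<in> verts H \<Longrightarrow> v \<in> verts H \<Longrightarrow> \<exists>p. pre_digraph.awalk H u p v \<and> length p \<le> n"
  shows "diameter H \<le> n"
proof -
  interpret wf_digraph H by fact
  have "\<mu> (\<lambda>_. 1) u v \<le> n" if uv: "u \<in> verts H" "v \<in> verts H" for u v
  proof -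
    obtain p where p: "awalk u p v" "length p \<le> n" using assms(2)[OF uv] by blast
    have "\<mu> (\<lambda>_. 1) u v \<le> awalk_cost (\<lambda>_. 1) p"
      using p(1) by (rule min_cost_le_walk_cost)
    also have "awalk_cost (\<lambda>_. 1) p = length p"
      by (simp add: awalk_cost_def sum_list_triv)
    finally show ?thesis using p(2) by (meson ereal_less_eq(3) of_nat_mono order_trans)
  qed
  then show ?thesis unfolding diameter_def by (intro SUP_least)
qed

theorem theorem1p2:
  fixes W :: "('a, 'b) monoid_scheme" and R :: "'a set"
  assumes "coxeter_group W R"
    and "infinite R \<or> card R \<ge> 2"
  shows
    "(\<forall>w0. finite (carrier W) \<and> longest_element W R w0 \<longrightarrow>
        card (pre_digraph.sccs (excess_zero_graph W R)) = 2 \<and>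
        verts ` pre_digraph.sccs (excess_zero_graph W R) = {involutions W - {w0}, {w0}}) \<and>
     (infinite (carrier W) \<longrightarrow> Digraph_Component.connected (excess_zero_graph W R)) \<and>
     (\<forall>w0 C. finite (carrier W) \<and> longest_element W R w0 \<and>
        C \<in> pre_digraph.sccs (excess_zero_graph W R) \<and> w0 \<notin> verts C \<longrightarrow> diameter C \<le> 3) \<and>
     (infinite (carrier W) \<longrightarrow> diameter (excess_zero_graph W R) \<le> 3)"
proof -
  interpret group W
    using assms(1) by (auto simp: coxeter_group_def has_presentation_def)
  interpret coxeter W R by unfold_locales fact
  interpret G: wf_digraph graph by (rule wf_graph)
  \<comment> \<open>The rank hypothesis is used in this form: it provides a generator, and a second
    one besides any given generator.\<close>
  have R2: "\<exists>r\<in>R. r \<noteq> x" for x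
  proof (rule ccontr)
    assume "\<not> ?thesis"
    then have "R \<subseteq> {x}" by auto
    then have "finite R" "card R \<le> 1" using card_mono[of "{x}" R] by (auto intro: finite_subset)
    then show False using assms(2) by simp
  qed
  have fin: "verts ` G.sccs = {involutions W - {w0}, {w0}}" "card G.sccs = 2"
    "\<forall>C\<in>G.sccs. w0 \<notin> verts C \<longrightarrow> diameter C \<le> 3"
    if w0: "finite (carrier W)" "longest_element W R w0" for w0
  proof -
    let ?V = "involutions W - {w0}"
    let ?H = "graph \<restriction> ?V"
    have w0I: "w0 \<in> involutions W" using longest_involution w0 R2 by blast
    \<comment> \<open>The short walks pass through \<open>R\<close>, so \<open>R\<close> must avoid
      \<open>w0\<close>. Otherwise another generator would lengthen \<open>w0\<close> from 1 to
      2.\<close>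
    have w0R: "w0 \<notin> R"
    proof
      assume w0R: "w0 \<in> R"
      obtain r where "r \<in> R" "r \<noteq> w0" using R2 by blast
      then have "len (r \<otimes>\<^bsub>W\<^esub> w0) = 2" using w0R len_mult_distinct by blast
      then show False using descents_longest[OF w0(2) \<open>r \<in> R\<close>] w0R by simp
    qed
    have wfH: "wf_digraph ?H" by (rule G.wellformed_induce_subgraph)
    have walk: "\<exists>p. pre_digraph.awalk ?H u p v \<and> length p \<le> 3" if "u \<in> ?V" "v \<in> ?V" for u v
      by (rule short_awalk[OF wfH])
        (use that w0R R_involutions longest_unique w0 in \<open>auto simp: induce_subgraph_def\<close>)
    have sub: "subgraph ?H graph"
      by (intro induced_imp_subgraph G.induced_induce) (auto simp: graph_simps)
    have reach: "u \<rightarrow>\<^sup>*\<^bsub>graph\<^esub> v" if "u \<in> ?V" "v \<in> ?V" for u v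
      using walk[OF that] wf_digraph.reachable_awalk[OF wfH] G.reachable_mono[OF _ sub] by blast
    have iso: "v = w0" if "w0 \<rightarrow>\<^sup>*\<^bsub>graph\<^esub> v" for v
      using that
    proof (cases rule: G.converse_reachable_cases)
      case (step z)
      then have "(w0, z) \<in> arcs graph" by simp
      then show ?thesis using longest_isolated[OF w0(2)] by blast
    qed simp
    have self: "w0 \<rightarrow>\<^sup>*\<^bsub>graph\<^esub> w0" using w0I by (simp add: graph_simps)
    obtain r where r: "r \<in> ?V" using R2 R_involutions w0R by blast
    \<comment> \<open>A component containing \<open>w0\<close> contains nothing else, as
      \<open>w0\<close> reaches only itself. Any other lies in \<open>?V\<close>, and maximality
      makes it all of \<open>?V\<close>.\<close>
    have "S \<in> {?V, {w0}}" if S: "S \<in> G.sccs_verts" for S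
    proof -
      note S' = S[unfolded G.in_sccs_verts_conv_reachable]
      note ne = S'[THEN conjunct1] and conn = S'[THEN conjunct2, THEN conjunct1]
        and max = S'[THEN conjunct2, THEN conjunct2]
      have SI: "S \<subseteq> involutions W"
      proof
        fix a assume "a \<in> S"
        then have "a \<rightarrow>\<^sup>*\<^bsub>graph\<^esub> a" by (intro conn[THEN bspec, THEN bspec])
        then have "a \<in> verts graph" by (rule G.reachable_in_verts(1))
        then show "a \<in> involutions W" by (simp add: graph_simps)
      qed
      show ?thesis
      proof (cases "w0 \<in> S")
        case True
        then have "a = w0" if "a \<in> S" for a
          using True that by (intro iso conn[THEN bspec, THEN bspec])
        with True show ?thesis by blast
      next
        case False
        then have "S \<subseteq> ?V" using SI by blast
        moreover have "v \<in> S" if v: "v \<in> ?V" for v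
        proof -
          obtain a where a: "a \<in> S" using ne by blast
          then have "a \<in> ?V" using \<open>S \<subseteq> ?V\<close> by blast
          then have "a \<rightarrow>\<^sup>*\<^bsub>graph\<^esub> v" "v \<rightarrow>\<^sup>*\<^bsub>graph\<^esub> a" using reach v by simp_all
          then show ?thesis using max[THEN bspec, OF a, THEN spec, of v] by simp
        qed
        ultimately have "S = ?V" by blast
        then show ?thesis by simp
      qed
    qed
    moreover have "?V \<in> G.sccs_verts"
      unfolding G.in_sccs_verts_conv_reachable
    proof (intro conjI ballI allI impI)
      fix u v assume u: "u \<in> ?V" and v: "v \<notin> ?V"
      show "\<not> u \<rightarrow>\<^sup>*\<^bsub>graph\<^esub> v \<or> \<not> v \<rightarrow>\<^sup>*\<^bsub>graph\<^esub> u"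
      proof (cases "v = w0")
        case True
        then show ?thesis using iso u by blast
      next
        case False
        then have "v \<notin> verts graph" using v by (simp add: graph_simps)
        then show ?thesis using G.reachable_in_verts(2)[of u v] by blast
      qed
    qed (use r reach in auto)
    moreover have "{w0} \<in> G.sccs_verts"
      unfolding G.in_sccs_verts_conv_reachable
    proof (intro conjI ballI allI impI)
      fix u v assume "u \<in> {w0}" "v \<notin> {w0}"
      then show "\<not> u \<rightarrow>\<^sup>*\<^bsub>graph\<^esub> v \<or> \<not> v \<rightarrow>\<^sup>*\<^bsub>graph\<^esub> u"
        using iso by blast
    qed (use self in auto)
    ultimately have "G.sccs_verts = {?V, {w0}}" by blast
    then have sccs: "G.sccs = {?H, graph \<restriction> {w0}}"
      by (simp add: G.sccs_conv_sccs_verts)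
    show "verts ` G.sccs = {?V, {w0}}" by (simp add: sccs)
    have "?H \<noteq> graph \<restriction> {w0}"
      by (metis DiffD2 induce_subgraph_verts insertI1)
    then show "card G.sccs = 2" by (simp add: sccs)
    have "diameter ?H \<le> 3"
      using diameter_le[OF wfH, of 3] walk by simp
    then show "\<forall>C\<in>G.sccs. w0 \<notin> verts C \<longrightarrow> diameter C \<le> 3" by (simp add: sccs)
  qed
  have walk: "\<exists>p. G.awalk u p v \<and> length p \<le> 3"
    if "infinite (carrier W)" "u \<in> verts graph" "v \<in> verts graph" for u v
    by (rule short_awalk[OF wf_graph])
      (use that R_involutions in \<open>auto simp: excess_zero_graph_def\<close>)
  have connected: "Digraph_Component.connected graph" if inf: "infinite (carrier W)"
  proof -
    \<comment> \<open>\<open>connected\<close> means strong connectivity of the symmetric closure,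
      so reachability in \<open>graph\<close> is lifted there; nonemptiness is a separate
      requirement.\<close>
    have "u \<rightarrow>\<^sup>*\<^bsub>with_proj (mk_symmetric graph)\<^esub> v"
      if "u \<in> verts graph" "v \<in> verts graph" for u v
      using walk[OF inf that] by (intro G.reachable_mk_symmetricI) (auto simp: G.reachable_awalk)
    moreover have "verts graph \<noteq> {}"
      using R2 R_involutions by (auto simp: graph_simps)
    ultimately show ?thesis
      unfolding Digraph_Component.connected_def strongly_connected_def by simp
  qed
  have diam: "diameter graph \<le> 3" if "infinite (carrier W)"
    using diameter_le[OF wf_graph, of 3] walk[OF that] by simp
  show ?thesis
    by (intro conjI allI impI; (elim conjE)?)
      (rule fin(1,2) fin(3)[rule_format] connected diam; assumption)+
qed

end
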